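(* Algorithm \textsf{E} (defined below), run on an undirected graph with vertex set $[n]$, takes $O(d)$ steps, where $d$ is the maximum of the diameters of the connected components of the graph.
   Context: Each edge $e$ has two ends $e.v,e.w$ (the edge set is never changed). Each vertex $v$ has a parent $v.p$, initially $v$. Vertices are compared as integers. Each operation is performed simultaneously for all edges/vertices using values at the start of the operation. \textsc{extended-connect}: for each edge $e$, let $x=e.v.p$, $y=e.w.p$; if $y<x$ send $y$ to $e.v$ and to $x$, else send $x$ to $e.w$ and to $y$. \textsc{update}: for each vertex $v$, replace $v.p$ by the minimum of $v.p$ and the vertices sent to $v$ in the preceding \textsc{extended-connect}. \textsc{shortcut}: for each vertex $v$, replace $v.p$ by $(v.p).p$. Algorithm \textsf{E}: repeat \{\textsc{extended-connect}; \textsc{update}; \textsc{shortcut}\} until no parent changes. Each iteration is a round; a round consists of a constant number of synchronous concurrent message-passing steps, so the number of steps is within a constant factor of the number of rounds. *)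

theory Defs
  imports Complex_Main "Graph_Theory.Digraph_Component"
begin

text \<open>An undirected graph is represented by a \<^typ>\<open>('a, 'b) pre_digraph\<close> that has one arc per
  undirected edge, listed with an arbitrary orientation: \<^const>\<open>tail\<close> and \<^const>\<open>head\<close> are the two
  ends $e.v$ and $e.w$.  Undirected notions are those of the symmetric closure.\<close>

definition undirected_components :: "('a, 'b) pre_digraph \<Rightarrow> ('a, 'a \<times> 'a) pre_digraph set" where
  "undirected_components G = pre_digraph.sccs (with_proj (mk_symmetric G))"

definition graph_dist :: "('a, 'b) pre_digraph \<Rightarrow> 'a \<Rightarrow> 'a \<Rightarrow> nat" where
  "graph_dist H u v = (LEAST k. \<exists>p. pre_digraph.awalk H u p v \<and> length p = k)"

definition graph_diameter :: "('a, 'b) pre_digraph \<Rightarrow> nat" where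
  "graph_diameter H = Max {graph_dist H u v | u v. u \<in> verts H \<and> v \<in> verts H}"

text \<open>For a nonempty finite graph this supremum is a maximum; it is 0 for the empty graph.\<close>

definition max_component_diameter :: "('a, 'b) pre_digraph \<Rightarrow> nat" where
  "max_component_diameter G = (SUP H \<in> undirected_components G. graph_diameter H)"

text \<open>The state of the algorithm is the parent function.  A message is a pair (recipient, vertex
  sent).\<close>

definition extended_connect :: "(nat, 'b) pre_digraph \<Rightarrow> (nat \<Rightarrow> nat) \<Rightarrow> (nat \<times> nat) set" where
  "extended_connect G p = (\<Union>e \<in> arcs G.
     let x = p (tail G e); y = p (head G e) in
     if y < x then {(tail G e, y), (x, y)} else {(head G e, x), (y, x)})"

definition update :: "(nat \<times> nat) set \<Rightarrow> (nat \<Rightarrow> nat) \<Rightarrow> nat \<Rightarrow> nat" where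
  "update M p v = Min (insert (p v) {u. (v, u) \<in> M})"

definition shortcut :: "(nat \<Rightarrow> nat) \<Rightarrow> nat \<Rightarrow> nat" where
  "shortcut p v = p (p v)"

definition round_E :: "(nat, 'b) pre_digraph \<Rightarrow> (nat \<Rightarrow> nat) \<Rightarrow> nat \<Rightarrow> nat" where
  "round_E G p = shortcut (update (extended_connect G p) p)"

definition parents_after :: "(nat, 'b) pre_digraph \<Rightarrow> nat \<Rightarrow> nat \<Rightarrow> nat" where
  "parents_after G i = (round_E G ^^ i) (\<lambda>v. v)"

definition changes_parent :: "(nat, 'b) pre_digraph \<Rightarrow> nat \<Rightarrow> bool" where
  "changes_parent G i \<longleftrightarrow> (\<exists>v \<in> verts G. parents_after G (Suc i) v \<noteq> parents_after G i v)"

text \<open>Rounds are numbered from 0.  The last of the \<open>r\<close> rounds, in which no parent changes, is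
  counted, so \<open>r\<close> is at least 1.\<close>

definition algorithm_E_rounds :: "(nat, 'b) pre_digraph \<Rightarrow> nat \<Rightarrow> bool" where
  "algorithm_E_rounds G r \<longleftrightarrow>
     (\<exists>l. r = Suc l \<and> \<not> changes_parent G l \<and> (\<forall>i < l. changes_parent G i))"

text \<open>Algorithm E, run with \<open>c\<close> message-passing steps per round, terminates after exactly \<open>s\<close>
  steps.\<close>

definition algorithm_E_steps :: "nat \<Rightarrow> (nat, 'b) pre_digraph \<Rightarrow> nat \<Rightarrow> bool" where
  "algorithm_E_steps c G s \<longleftrightarrow> (\<exists>r. algorithm_E_rounds G r \<and> s = c * r)"

end

theory Submission
  imports Defs
begin

text \<open>Parents never increase, and they never leave the component of their vertex. Since an
  edge sends the smaller of its two parents to the end with the larger one, the parent of \<open>v\<close> after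
  \<open>k\<close> rounds is at most the smallest vertex within distance \<open>k\<close> of \<open>v\<close>; the shortcuts
  can only help. After \<open>d\<close> rounds every parent is therefore the smallest vertex of its component, and
  no parent changes any more.\<close>

section \<open>Effect of a single round\<close>

lemma parents_after_0 [simp]: "parents_after G 0 v = v"
  by (simp add: parents_after_def)

lemma parents_after_Suc: "parents_after G (Suc i) = round_E G (parents_after G i)"
  by (simp add: parents_after_def)

lemma finite_extended_connect:
  assumes "finite (arcs G)"
  shows "finite (extended_connect G p)"
  using assms by (auto simp: extended_connect_def Let_def)

text \<open>\<open>Min\<close> is meaningful only on finite sets; this finiteness is what makes
  \<open>update\<close> a true minimum.\<close>

lemma finite_messages_to:
  assumes "finite M"
  shows "finite {u. (v, u) \<in> M}"
  by (rule finite_subset[of _ "snd ` M"]) (use assms in force)+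

lemma update_le:
  assumes "finite M"
  shows "update M p v \<le> p v"
  unfolding update_def using finite_messages_to[OF assms] by (intro Min_le) auto

lemma update_le_message:
  assumes "finite M" "(v, u) \<in> M"
  shows "update M p v \<le> u"
  unfolding update_def using finite_messages_to[OF assms(1)] assms(2) by (intro Min_le) auto

lemma update_cases:
  assumes "finite M"
  obtains "update M p v = p v" | "(v, update M p v) \<in> M"
proof -
  have "update M p v \<in> insert (p v) {u. (v, u) \<in> M}"
    unfolding update_def using finite_messages_to[OF assms] by (intro Min_in) auto
  then show thesis using that by auto
qed

text \<open>If \<open>p w < p v\<close>, an edge joining \<open>v\<close> and \<open>w\<close> sends
  \<open>p w\<close> to \<open>v\<close>, whichever orientation it is listed with. Otherwise
  \<open>p v \<le> p w\<close> already, and \<open>update\<close> never increases a parent.\<close>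

lemma update_extended_connect_le_neighbour:
  assumes "finite (arcs G)" "(v, w) \<in> parcs (mk_symmetric G)"
  shows "update (extended_connect G p) p v \<le> p w"
proof (cases "p w < p v")
  case True
  with assms(2) have "(v, p w) \<in> extended_connect G p"
    by (force simp: extended_connect_def parcs_mk_symmetric Let_def)
  then show ?thesis
    by (rule update_le_message[OF finite_extended_connect[OF assms(1)]])
next
  case False
  then show ?thesis
    using update_le[OF finite_extended_connect[OF assms(1)]] by (meson not_less order_trans)
qed

text \<open>With \<open>q\<close> the updated parents, the round yields \<open>q (q v)\<close>.
  Since \<open>q x \<le> p x \<le> x\<close> for every \<open>x\<close>, taking
  \<open>x = q v\<close> shows that the shortcut does not increase the value.\<close>

lemma round_E_le_update:
  assumes "finite (arcs G)" "\<And>v. p v \<le> v"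
  shows "round_E G p v \<le> update (extended_connect G p) p v"
  using update_le[OF finite_extended_connect[OF assms(1)]] assms(2)
  unfolding round_E_def shortcut_def by (meson order_trans)

section \<open>Parents over successive rounds\<close>

lemma parents_after_le_self:
  assumes "finite (arcs G)"
  shows "parents_after G i v \<le> v"
proof (induction i arbitrary: v)
  case (Suc i)
  show ?case
    using round_E_le_update[OF assms Suc.IH]
      update_le[OF finite_extended_connect[OF assms]] Suc.IH
    unfolding parents_after_Suc by (meson order_trans)
qed simp

lemma parents_after_antimono:
  assumes "finite (arcs G)" "i \<le> j"
  shows "parents_after G j v \<le> parents_after G i v"
  using assms(2)
proof (induction j rule: dec_induct)
  case (step j)
  show ?case
    using round_E_le_update[OF assms(1) parents_after_le_self[OF assms(1)]]
      update_le[OF finite_extended_connect[OF assms(1)]] step.IH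
    unfolding parents_after_Suc by (meson order_trans)
qed simp

lemma parents_after_Suc_le_neighbour:
  assumes "finite (arcs G)" "(v, w) \<in> parcs (mk_symmetric G)"
  shows "parents_after G (Suc i) v \<le> parents_after G i w"
  using round_E_le_update[OF assms(1) parents_after_le_self[OF assms(1)]]
    update_extended_connect_le_neighbour[OF assms]
  unfolding parents_after_Suc by (meson order_trans)

lemma sym_rtrancl_mk_symmetric: "sym ((parcs (mk_symmetric G))\<^sup>*)"
  by (intro sym_rtrancl symI) (auto simp: parcs_mk_symmetric)

text \<open>The recipient is an end of some edge or the parent of that end, and the vertex sent is
  the parent of the other end. A path leads from the recipient to its end, across the edge, and on
  to that parent; symmetry allows the step from a parent back to its child.\<close>

lemma message_connected:
  assumes "\<And>v. (v, p v) \<in> (parcs (mk_symmetric G))\<^sup>*" "(v, u) \<in> extended_connect G p"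
  shows "(v, u) \<in> (parcs (mk_symmetric G))\<^sup>*"
proof -
  let ?R = "(parcs (mk_symmetric G))\<^sup>*"
  obtain e where e: "e \<in> arcs G"
    and vu: "(v = tail G e \<or> v = p (tail G e)) \<and> u = p (head G e) \<or>
      (v = head G e \<or> v = p (head G e)) \<and> u = p (tail G e)"
    using assms(2) by (auto simp: extended_connect_def Let_def split: if_splits)
  have "(tail G e, head G e) \<in> ?R" "(head G e, tail G e) \<in> ?R"
    using e by (auto simp: parcs_mk_symmetric intro!: r_into_rtrancl)
  moreover have "(p w, w) \<in> ?R" for w
    using assms(1) sym_rtrancl_mk_symmetric by (meson symD)
  ultimately show ?thesis
    using vu assms(1) by (meson rtrancl_trans)
qed

lemma parents_after_connected:
  assumes "finite (arcs G)"
  shows "(v, parents_after G i v) \<in> (parcs (mk_symmetric G))\<^sup>*"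
proof (induction i arbitrary: v)
  case (Suc i)
  let ?q = "update (extended_connect G (parents_after G i)) (parents_after G i)"
  \<comment> \<open>An updated parent is the old parent or a received vertex, both connected to
    \<open>w\<close>; the shortcut then composes two such links.\<close>
  have "(w, ?q w) \<in> (parcs (mk_symmetric G))\<^sup>*" for w
    using Suc.IH message_connected[OF Suc.IH]
    by (metis update_cases[OF finite_extended_connect[OF assms]])
  then show ?case
    unfolding parents_after_Suc round_E_def shortcut_def by (meson rtrancl_trans)
qed simp

text \<open>Each arc of the walk costs one round: the parent of \<open>u\<close> after
  \<open>k + 1\<close> rounds is at most the parent of the next vertex after \<open>k\<close>
  rounds. Walks in a subgraph \<open>H\<close> are allowed because distances are measured inside
  components.\<close>

lemma parents_after_le_walk_end:
  assumes "finite (arcs G)" "subgraph H (with_proj (mk_symmetric G))"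
    and "pre_digraph.awalk H u p v"
  shows "parents_after G (length p) u \<le> v"
  using assms(3)
proof (induction p arbitrary: u)
  case Nil
  then show ?case by (simp add: pre_digraph.awalk_def pre_digraph.cas.simps)
next
  case (Cons e p)
  interpret H: wf_digraph H using assms(2) by (simp add: subgraph_def)
  have e: "e \<in> arcs H" "u = tail H e" and walk: "H.awalk (head H e) p v"
    using Cons.prems by (auto simp: H.awalk_Cons_iff)
  have "(u, head H e) \<in> parcs (mk_symmetric G)"
    using e assms(2) by (auto simp: subgraph_def compatible_def with_proj_def)
  then show ?case
    using parents_after_Suc_le_neighbour[OF assms(1)] Cons.IH[OF walk]
    by (metis length_Cons order_trans)
qed

section \<open>Distances, diameters and components\<close>

lemma graph_dist_awalk:
  assumes "wf_digraph H" "u \<rightarrow>\<^sup>*\<^bsub>H\<^esub> v"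
  obtains p where "pre_digraph.awalk H u p v" "length p = graph_dist H u v"
proof -
  \<comment> \<open>Reachability guarantees that the \<open>LEAST\<close> in
    \<open>graph_dist\<close> is attained by a walk.\<close>
  have "\<exists>k p. pre_digraph.awalk H u p v \<and> length p = k"
    using assms by (simp add: wf_digraph.reachable_awalk)
  from LeastI_ex[OF this] show thesis
    unfolding graph_dist_def[symmetric] using that by blast
qed

lemma graph_dist_le_graph_diameter:
  assumes "finite (verts H)" "u \<in> verts H" "v \<in> verts H"
  shows "graph_dist H u v \<le> graph_diameter H"
proof -
  have "{graph_dist H u v | u v. u \<in> verts H \<and> v \<in> verts H}
      = (\<lambda>(u, v). graph_dist H u v) ` (verts H \<times> verts H)"
    by auto
  then show ?thesis
    unfolding graph_diameter_def using assms by (intro Max_ge) auto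
qed

text \<open>The supremum over components bounds each diameter only if it is taken over a bounded
  set. Components are induced by their vertex sets, which lie in the finite power set of
  \<open>verts G\<close>.\<close>

lemma finite_undirected_components:
  assumes "fin_digraph G"
  shows "finite (undirected_components G)"
proof -
  interpret G: fin_digraph G by fact
  interpret S: pair_fin_digraph "mk_symmetric G" by blast
  have "S.sccs_verts \<subseteq> Pow (verts G)"
    using S.reachable_in_verts by (fastforce simp: S.sccs_verts_def)
  then have "finite S.sccs_verts"
    by (rule finite_subset) simp
  then show ?thesis
    by (simp add: undirected_components_def S.sccs_conv_sccs_verts)
qed

lemma graph_diameter_le_max_component_diameter:
  assumes "fin_digraph G" "H \<in> undirected_components G"
  shows "graph_diameter H \<le> max_component_diameter G"
  unfolding max_component_diameter_def
  using finite_undirected_components[OF assms(1)] assms(2)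
  by (intro cSUP_upper bdd_above_finite finite_imageI)

text \<open>In a symmetric digraph the vertices reachable from \<open>v\<close> induce a strongly
  connected component. This links the library's components to the closure used for parents.\<close>

lemma undirected_component_of_vertex:
  assumes "wf_digraph G" "v \<in> verts G"
  obtains H where "H \<in> undirected_components G"
    "verts H = {w. (v, w) \<in> (parcs (mk_symmetric G))\<^sup>*}"
proof -
  interpret G: wf_digraph G by fact
  interpret W: pair_wf_digraph "mk_symmetric G" by blast
  interpret S: sym_digraph "with_proj (mk_symmetric G)"
    by unfold_locales (rule symmetric_mk_symmetric)
  \<comment> \<open>Library reachability is reflexive only on vertices, so the base case uses
    \<open>v \<in> verts G\<close>.\<close>
  have "(v, w) \<in> (parcs (mk_symmetric G))\<^sup>* \<longleftrightarrow> v \<rightarrow>\<^sup>*\<^bsub>mk_symmetric G\<^esub> w" for w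
  proof
    assume "(v, w) \<in> (parcs (mk_symmetric G))\<^sup>*"
    then show "v \<rightarrow>\<^sup>*\<^bsub>mk_symmetric G\<^esub> w"
    proof induction
      case base
      then show ?case using assms(2) by simp
    next
      case (step y z)
      then show ?case by (auto intro: W.reachable_adj_trans)
    qed
  next
    assume "v \<rightarrow>\<^sup>*\<^bsub>mk_symmetric G\<^esub> w"
    from reachable_rtranclI[OF this] show "(v, w) \<in> (parcs (mk_symmetric G))\<^sup>*" by simp
  qed
  then show thesis
    using that[of "with_proj (mk_symmetric G) \<restriction> {w. v \<rightarrow>\<^sup>*\<^bsub>mk_symmetric G\<^esub> w}"]
      S.induce_reachable_is_in_sccs[of v] assms(2)
    by (simp add: undirected_components_def)
qed

text \<open>A shortest walk to the minimum gives the upper bound, and staying inside the component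
  gives the lower one. Every \<open>i\<close> from the diameter bound on is covered, so two
  successive rounds can be compared to detect termination.\<close>

lemma parents_after_eq_Min_component:
  assumes "fin_digraph G" "H \<in> undirected_components G"
    and "verts H = {w. (v, w) \<in> (parcs (mk_symmetric G))\<^sup>*}"
    and "max_component_diameter G \<le> i"
  shows "parents_after G i v = Min (verts H)"
proof (rule antisym)
  interpret G: fin_digraph G by fact
  have H: "subgraph H (with_proj (mk_symmetric G))" "strongly_connected H"
    using assms(2) by (auto simp: undirected_components_def pre_digraph.sccs_def
        intro: induced_imp_subgraph)
  then have "wf_digraph H" and "verts H \<subseteq> verts G"
    by (auto simp: subgraph_def)
  from this(2) have fin: "finite (verts H)"
    by (rule finite_subset) simp
  let ?m = "Min (verts H)"
  have v: "v \<in> verts H"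
    using assms(3) by simp
  with fin have m: "?m \<in> verts H"
    by (intro Min_in) auto
  have "v \<rightarrow>\<^sup>*\<^bsub>H\<^esub> ?m"
    using H(2) v m by (simp add: strongly_connected_def)
  from graph_dist_awalk[OF \<open>wf_digraph H\<close> this]
  obtain p where p: "pre_digraph.awalk H v p ?m" "length p = graph_dist H v ?m" .
  have "length p \<le> i"
    using p(2) graph_dist_le_graph_diameter[OF fin v m]
      graph_diameter_le_max_component_diameter[OF assms(1,2)] assms(4) by linarith
  then show "parents_after G i v \<le> ?m"
    using parents_after_antimono[OF G.finite_arcs] parents_after_le_walk_end[OF G.finite_arcs H(1) p(1)]
    by (meson order_trans)
  show "?m \<le> parents_after G i v"
    using fin parents_after_connected[OF G.finite_arcs] assms(3) by (intro Min_le) auto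
qed

lemma not_changes_parent_max_component_diameter:
  assumes "fin_digraph G"
  shows "\<not> changes_parent G (max_component_diameter G)"
proof -
  interpret G: fin_digraph G by fact
  show ?thesis
    unfolding changes_parent_def
    using undirected_component_of_vertex[OF G.wf_digraph_axioms]
      parents_after_eq_Min_component[OF assms]
    by (metis le_SucI order_refl)
qed

lemma algorithm_E_rounds_le:
  assumes "fin_digraph G"
  obtains r where "algorithm_E_rounds G r" "r \<le> Suc (max_component_diameter G)"
proof -
  let ?l = "LEAST l. \<not> changes_parent G l"
  note stop = not_changes_parent_max_component_diameter[OF assms]
  \<comment> \<open>Rounds are numbered from 0, so stopping at index \<open>?l\<close> means
    \<open>Suc ?l\<close> rounds, the unchanging one included.\<close>
  have "algorithm_E_rounds G (Suc ?l)"
    unfolding algorithm_E_rounds_def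
    using LeastI[of "\<lambda>l. \<not> changes_parent G l", OF stop] not_less_Least by blast
  moreover have "?l \<le> max_component_diameter G"
    by (rule Least_le) (rule stop)
  ultimately show thesis
    using that by simp
qed

theorem theorem9:
  fixes c :: nat
  shows "\<exists>C::real. \<forall>(n::nat) (G :: (nat, nat) pre_digraph).
           fin_digraph G \<and> verts G = {1..n} \<longrightarrow>
           (\<exists>s. algorithm_E_steps c G s \<and>
                real s \<le> C * real (max 1 (max_component_diameter G)))"
proof (intro exI[of _ "real (2 * c)"] allI impI)
  fix n :: nat and G :: "(nat, nat) pre_digraph"
  assume "fin_digraph G \<and> verts G = {1..n}"
  then obtain r where r: "algorithm_E_rounds G r" "r \<le> Suc (max_component_diameter G)"
    using algorithm_E_rounds_le by blast
  \<comment> \<open>With \<open>d\<close> the maximum diameter,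
    \<open>Suc d \<le> 2 * max 1 d\<close>, whence the constant \<open>2 * c\<close>. The
    \<open>max\<close> covers \<open>d = 0\<close>, where one round still runs.\<close>
  have "c * r \<le> c * (2 * max 1 (max_component_diameter G))"
    using r(2) by (intro mult_left_mono) auto
  then have "real (c * r) \<le> real (2 * c) * real (max 1 (max_component_diameter G))"
    unfolding of_nat_mult[symmetric] of_nat_le_iff by (simp add: ac_simps)
  then show "\<exists>s. algorithm_E_steps c G s \<and>
      real s \<le> real (2 * c) * real (max 1 (max_component_diameter G))"
    using r(1) unfolding algorithm_E_steps_def by blast
qed

end
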